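(* Let $n\ge1$ be the number of nodes, $0<\hat\lambda\le e^{-1}$ the aggregate input rate, $\lambda=\hat\lambda/n$, $1\le K\le\infty$ the cutoff phase, $0<q<1$ the retransmission factor, and $p_S=\exp(W_{-1}(-\hat\lambda))$. If $$q\le q_u:=\frac{-\ln p_S}{n}=\frac{-W_{-1}(-\hat\lambda)}{n},$$ then at any time slot $t$ the attempt rate of $K$-exponential backoff satisfies $G_t\le-\ln p_S$.
   Context: $W_{-1}$ is the real branch of the Lambert W function ($W(z)e^{W(z)}=z$, $-e^{-1}\le z<0$) with values $\le-1$. Attempt rate: if at time slot $t$ there are $n_b$ backlogged nodes ($0\le n_b\le n$), of which $n_i\ge0$ have their head-of-line packet in phase $i$ (having suffered $i$ collisions, capped at $K$), $i=1,\dots,K$, with $\sum_{i=1}^Kn_i=n_b$, then, since a phase-$i$ packet is transmitted with probability $q^i$ and each of the remaining $n-n_b$ nodes attempts at rate $\lambda$, $$G_t=(n-n_b)\lambda+\sum_{i=1}^{K}n_iq^i .$$ The claim is to hold for every possible state $(n_b;n_1,n_2,\dots)$. *)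

theory Defs
  imports "HOL-Analysis.Analysis" "HOL-Library.Extended_Nat" "HOL-Real_Asymp.Real_Asymp"
begin

(* Meaningful only for -exp (-1) \<le> z < 0; see lambert_Wm1_ex1. *)
definition lambert_Wm1 :: "real \<Rightarrow> real" where
  "lambert_Wm1 z = (THE w. w \<le> -1 \<and> w * exp w = z)"

lemma lambert_Wm1_ex1:
  fixes z :: real
  assumes "- exp (-1) \<le> z" "z < 0"
  shows "\<exists>!w. w \<le> -1 \<and> w * exp w = z"
proof -
  have dec: "y * exp y < x * exp x" if "x < y" "y \<le> -1" for x y :: real
  proof (rule DERIV_neg_imp_decreasing_open[OF \<open>x < y\<close>])
    fix w :: real assume "x < w" "w < y"
    with that have "(1 + w) * exp w < 0"
      by (intro mult_neg_pos) auto
    moreover have "((\<lambda>w. w * exp w) has_real_derivative (1 + w) * exp w) (at w)"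
      by (auto intro!: derivative_eq_intros simp: algebra_simps)
    ultimately show "\<exists>d. ((\<lambda>w. w * exp w) has_real_derivative d) (at w) \<and> d < 0"
      by blast
  qed (intro continuous_intros)
  have "((\<lambda>w::real. w * exp w) \<longlongrightarrow> 0) at_bot"
    by real_asymp
  then have "eventually (\<lambda>w::real. z < w * exp w) at_bot"
    using assms(2) by (rule order_tendstoD)
  then have "eventually (\<lambda>w::real. z < w * exp w \<and> w \<le> -1) at_bot"
    using eventually_le_at_bot by (rule eventually_conj)
  then obtain a :: real where a: "z < a * exp a" "a \<le> -1"
    by (auto dest: eventually_happens)
  have "\<exists>w. a \<le> w \<and> w \<le> -1 \<and> w * exp w = z"
    using a assms(1) by (intro IVT2') (auto intro!: continuous_intros)
  moreover have "v = w" if "v \<le> -1" "v * exp v = z" "w \<le> -1" "w * exp w = z" for v w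
    using dec[of v w] dec[of w v] that by linarith
  ultimately show ?thesis by blast
qed

definition phases :: "enat \<Rightarrow> nat set" where
  "phases K = {i. 1 \<le> i \<and> enat i \<le> K}"

(* ns i is the number of backlogged nodes whose head-of-line packet is in phase i.
   For K = \<infinity> the sum has infinitely many terms; since they are naturals,
   all but finitely many vanish. *)
definition backoff_state :: "nat \<Rightarrow> enat \<Rightarrow> nat \<Rightarrow> (nat \<Rightarrow> nat) \<Rightarrow> bool" where
  "backoff_state n K nb ns \<longleftrightarrow>
     nb \<le> n \<and> ((\<lambda>i. real (ns i)) has_sum real nb) (phases K)"

definition attempt_rate ::
  "nat \<Rightarrow> real \<Rightarrow> enat \<Rightarrow> real \<Rightarrow> nat \<Rightarrow> (nat \<Rightarrow> nat) \<Rightarrow> real" where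
  "attempt_rate n lam K q nb ns =
     (real n - real nb) * lam + (\<Sum>\<^sub>\<infinity>i\<in>phases K. real (ns i) * q ^ i)"

end

theory Submission imports Defs begin

text \<open>The attempt rate is a sum of \<open>n\<close> per-node contributions, and each is at
  most \<open>q_u\<close>. A backlogged node in phase i \<ge> 1 contributes \<open>q ^ i\<close>,
  which is at most q \<le> \<open>q_u\<close> (\<open>attempt_rate_le\<close>). Any other node
  contributes \<open>lam\<close>. With \<open>w = lambert_Wm1 (- lam_hat)\<close> the defining
  equation gives \<open>lam_hat = - w * exp w\<close>, and this is at most \<open>- w\<close>
  because \<open>w\<close> is negative; division by \<open>n\<close> yields \<open>lam\<close> \<le>
  \<open>q_u\<close>. Hence the total is at most \<open>n * q_u = - w = - ln p_S\<close>.\<close>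

lemma lambert_Wm1:
  assumes "- exp (-1) \<le> z" "z < 0"
  shows lambert_Wm1_le: "lambert_Wm1 z \<le> -1"
    and lambert_Wm1_eq: "lambert_Wm1 z * exp (lambert_Wm1 z) = z"
  using theI'[OF lambert_Wm1_ex1[OF assms]] unfolding lambert_Wm1_def by auto

text \<open>Phases start at 1, so every backlogged node attempts with probability at most
  \<open>q\<close>, however the backlog is spread over the phases.\<close>

lemma attempt_rate_le:
  assumes "backoff_state n K nb ns" "0 \<le> q" "q \<le> 1"
  shows "attempt_rate n lam K q nb ns \<le> (real n - real nb) * lam + real nb * q"
proof -
  have sum: "((\<lambda>i. real (ns i) * q) has_sum real nb * q) (phases K)"
    using assms(1) unfolding backoff_state_def by (intro has_sum_cmult_left) auto
  have le: "real (ns i) * q ^ i \<le> real (ns i) * q" if "i \<in> phases K" for i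
  proof -
    have "q ^ i \<le> q ^ 1"
      using that assms by (intro power_decreasing) (auto simp: phases_def)
    then show ?thesis
      by (intro mult_left_mono) auto
  qed
  \<comment> \<open>Matters for infinite \<open>K\<close>: a non-summable \<open>infsum\<close>
    would default to 0. The terms are nonnegative and dominated by a family with sum
    \<open>nb * q\<close>.\<close>
  have "(\<lambda>i. real (ns i) * q ^ i) summable_on phases K"
    using sum le assms(2)
    by (intro summable_on_comparison_test[OF has_sum_imp_summable[OF sum]]) auto
  then have "(\<Sum>\<^sub>\<infinity>i\<in>phases K. real (ns i) * q ^ i) \<le> real nb * q"
    using sum le by (intro has_sum_mono[OF has_sum_infsum])
  then show ?thesis
    by (simp add: attempt_rate_def)
qed

theorem theorem3:
  fixes n :: nat and lam_hat lam q q_u p_S :: real and K :: enat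
  assumes "n \<ge> 1"
    and "0 < lam_hat" and "lam_hat \<le> exp (-1)"
    and "lam = lam_hat / real n"
    and "1 \<le> K"
    and "0 < q" and "q < 1"
    and "p_S = exp (lambert_Wm1 (- lam_hat))"
    and "q_u = - ln p_S / real n"
  shows "q_u = - lambert_Wm1 (- lam_hat) / real n \<and>
    (q \<le> q_u \<longrightarrow>
      (\<forall>nb ns. backoff_state n K nb ns \<longrightarrow> attempt_rate n lam K q nb ns \<le> - ln p_S))"
proof -
  define w where "w = lambert_Wm1 (- lam_hat)"
  have "w \<le> -1" "w * exp w = - lam_hat"
    unfolding w_def using assms(2,3) by (auto intro: lambert_Wm1_le lambert_Wm1_eq)
  have q_u: "q_u = - w / real n"
    using assms(8,9) by (simp add: w_def)
  \<comment> \<open>Here \<open>exp w\<close> \<le> 1, as \<open>w\<close> is negative.\<close>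
  have "- w * exp w \<le> - w * 1"
    using \<open>w \<le> -1\<close> by (intro mult_left_mono) auto
  then have "lam_hat \<le> - w"
    using \<open>w * exp w = - lam_hat\<close> by simp
  then have lam: "lam \<le> q_u"
    unfolding q_u assms(4) by (intro divide_right_mono) auto
  have "attempt_rate n lam K q nb ns \<le> - ln p_S"
    if "q \<le> q_u" and state: "backoff_state n K nb ns" for nb ns
  proof -
    have "attempt_rate n lam K q nb ns \<le> (real n - real nb) * lam + real nb * q"
      using state assms(6,7) by (intro attempt_rate_le) auto
    \<comment> \<open>The bound \<open>nb\<close> \<le> \<open>n\<close> makes the weight of
      \<open>lam\<close> nonnegative.\<close>
    also have "\<dots> \<le> (real n - real nb) * q_u + real nb * q_u"
      using state lam that(1) unfolding backoff_state_def
      by (intro add_mono mult_left_mono) auto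
    also have "\<dots> = real n * q_u"
      by (simp add: algebra_simps)
    also have "\<dots> = - ln p_S"
      using assms(1,9) by simp
    finally show ?thesis .
  qed
  with q_u show ?thesis
    unfolding w_def by blast
qed

end
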